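(* Let $A$ denote the $(0,1)$-adjacency matrix of a connected $k$-regular simple graph on $n$ vertices. Let $\lambda$ be an eigenvalue of $A$ of multiplicity $n-d$, $d\geq 2$, such that $\lambda\notin\{0,-1,k\}$ and $A$ has no eigenvalue equal to $\frac{\lambda(2\lambda-2k-\lambda n)}{2\lambda-2k+n}$. Then $$n\leq \frac{1}{2}d(d-1).$$
   Context: A simple graph is finite, undirected, without loops or multiple edges. *)

theory Defs
  imports "HOL-Analysis.Analysis" "Graph_Theory.Digraph_Component"
begin

text \<open>
  A simple graph is a symmetric, finite digraph without loops and parallel arcs
  (locale \<^locale>\<open>graph\<close> of the Graph-Theory library): every edge is a pair of opposite arcs, so
  the degree of a vertex is its out-degree. In order to use the matrices of HOL-Analysis, the
  vertex set is taken to be the universe of a finite type.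
\<close>

definition regular_graph :: "('v, 'e) pre_digraph \<Rightarrow> nat \<Rightarrow> bool" where
  "regular_graph G k \<longleftrightarrow> graph G \<and> (\<forall>v \<in> verts G. out_degree G v = k)"

definition adjacency_matrix :: "('v::finite, 'e) pre_digraph \<Rightarrow> real ^ 'v ^ 'v" where
  "adjacency_matrix G = (\<chi> u v. if u \<rightarrow>\<^bsub>G\<^esub> v then 1 else 0)"

definition eigenvalue :: "real ^ 'n ^ 'n \<Rightarrow> real \<Rightarrow> bool" where
  "eigenvalue A \<mu> \<longleftrightarrow> (\<exists>x. x \<noteq> 0 \<and> A *v x = \<mu> *\<^sub>R x)"

definition eigenspace :: "real ^ 'n ^ 'n \<Rightarrow> real \<Rightarrow> (real ^ 'n) set" where
  "eigenspace A \<mu> = {x. A *v x = \<mu> *\<^sub>R x}"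

text \<open>
  Geometric multiplicity; for the symmetric real matrices considered here it agrees with the
  multiplicity as a root of the characteristic polynomial.
\<close>

definition eigenvalue_multiplicity :: "real ^ 'n ^ 'n \<Rightarrow> real \<Rightarrow> nat" where
  "eigenvalue_multiplicity A \<mu> = dim (eigenspace A \<mu>)"

end

theory Submission
  imports Defs
begin

text \<open>
  Put \<open>M = \<lambda>I - A - t J\<close> with \<open>t = (\<lambda> - k) / n\<close>. The choice of \<open>t\<close> makes the all-ones vector an
  additional element of the kernel, which already contains the eigenspace of \<open>\<lambda>\<close>; so \<open>M\<close> has rank at
  most \<open>d - 1\<close>. Every row of the entrywise square \<open>N\<close> of \<open>M\<close> is the entrywise square of a row of \<open>M\<close>,
  hence \<open>N\<close> has rank at most \<open>(d - 1) d / 2\<close>. It remains to see that \<open>N\<close> is nonsingular. As \<open>A\<close> has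
  entries in \<open>{0, 1}\<close>, we have \<open>N = (\<lambda>\<^sup>2 - 2 \<lambda> t) I + (1 + 2 t) A + t\<^sup>2 J\<close>. The all-ones vector is an
  eigenvector of \<open>N\<close> whose eigenvalue is the sum of squares of a row of \<open>M\<close>, which is nonzero because
  \<open>\<lambda>\<close> is neither \<open>0\<close> nor \<open>-1\<close>. A kernel vector of \<open>N\<close> orthogonal to it would be an eigenvector of
  \<open>A\<close> for \<open>\<lambda> (2 t - \<lambda>) / (1 + 2 t)\<close>, which is the excluded value, or
  vanish if \<open>1 + 2 t = 0\<close>, as then \<open>\<lambda> (2 t - \<lambda>) = - \<lambda> (\<lambda> + 1) \<noteq> 0\<close>.
\<close>

text \<open>Inserting \<open>b\<close> adds only values \<open>f b y\<close> with \<open>y\<close>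
  in \<open>insert b B\<close>, since symmetry absorbs the pairs with \<open>b\<close> on the
  right.\<close>

lemma card_symmetric_image_le:
  assumes "finite B" and "\<And>x y. f x y = f y x"
  shows "2 * card (case_prod f ` (B \<times> B)) \<le> card B * (card B + 1)"
  using assms(1)
proof induction
  case (insert b B)
  have "case_prod f ` (insert b B \<times> insert b B)
      \<subseteq> case_prod f ` (B \<times> B) \<union> f b ` insert b B"
    using assms(2) by auto
  then have "card (case_prod f ` (insert b B \<times> insert b B))
      \<le> card (case_prod f ` (B \<times> B) \<union> f b ` insert b B)"
    using insert.hyps by (intro card_mono) auto
  also have "\<dots> \<le> card (case_prod f ` (B \<times> B)) + card (f b ` insert b B)"
    by (rule card_Un_le)
  also have "card (f b ` insert b B) \<le> card (insert b B)"
    using insert.hyps by (intro card_image_le) auto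
  finally show ?case
    using insert by simp
qed simp

lemma bilinear_in_span:
  assumes "bilinear f" and "x \<in> span B" and "y \<in> span B"
  shows "f x y \<in> span (case_prod f ` (B \<times> B))"
  using assms(2)
proof (induction rule: span_induct_alt)
  case base
  then show ?case using assms(1) by (simp add: bilinear_lzero span_zero)
next
  case (step c b z)
  have "f b y \<in> span (case_prod f ` (B \<times> B))"
    using assms(3)
  proof (induction rule: span_induct_alt)
    case base
    then show ?case using assms(1) by (simp add: bilinear_rzero span_zero)
  next
    case (step c' b' z')
    have "f b b' \<in> span (case_prod f ` (B \<times> B))"
      using \<open>b \<in> B\<close> step by (intro span_base) auto
    with step assms(1) show ?case
      by (simp add: bilinear_radd bilinear_rmul span_add span_mul)
  qed
  with step assms(1) show ?case
    by (simp add: bilinear_ladd bilinear_lmul span_add span_mul)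
qed

text \<open>Expanding both arguments over a basis \<open>B\<close> of the span of \<open>V\<close>
  puts every \<open>f x x\<close> into the span of the values of \<open>f\<close> on pairs from
  \<open>B\<close>; symmetry halves the count of these.\<close>

lemma dim_symmetric_bilinear_diagonal_le:
  fixes f :: "'a::euclidean_space \<Rightarrow> 'a \<Rightarrow> 'b::euclidean_space"
  assumes "bilinear f" and "\<And>x y. f x y = f y x"
  shows "2 * dim ((\<lambda>x. f x x) ` V) \<le> dim V * (dim V + 1)"
proof -
  obtain B where B: "V \<subseteq> span B" "independent B" "card B = dim V"
    using basis_exists by blast
  have "finite B"
    using B(2) by (rule independent_imp_finite)
  moreover have "(\<lambda>x. f x x) ` V \<subseteq> span (case_prod f ` (B \<times> B))"
    using B(1) assms(1) by (auto intro: bilinear_in_span)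
  ultimately have "dim ((\<lambda>x. f x x) ` V) \<le> card (case_prod f ` (B \<times> B))"
    by (intro dim_le_card) auto
  then show ?thesis
    using card_symmetric_image_le[OF \<open>finite B\<close>, of f] assms(2) B(3) by fastforce
qed

text \<open>The product \<open>*\<close> of vectors is componentwise, hence a symmetric bilinear
  map.\<close>

lemma rank_hadamard_square_le:
  fixes M N :: "real ^ 'n ^ 'm"
  assumes "\<And>i j. N $ i $ j = (M $ i $ j)\<^sup>2"
  shows "2 * rank N \<le> rank M * (rank M + 1)"
proof -
  have "row i N = row i M * row i M" for i
    using assms by (simp add: row_def vec_eq_iff power2_eq_square)
  then have "rows N = (\<lambda>x. x * x) ` rows M"
    by (auto simp: rows_def image_def)
  then show ?thesis
    using dim_symmetric_bilinear_diagonal_le[OF bilinear_times mult.commute, of "rows M"]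
    by (simp add: row_rank_def)
qed

text \<open>The kernel is the orthogonal complement of the row space.\<close>

lemma rank_add_dim_kernel:
  fixes M :: "real ^ 'n ^ 'm"
  shows "rank M + dim {x. M *v x = 0} = CARD('n)"
proof -
  have "M *v x = 0 \<longleftrightarrow> (\<forall>y \<in> rows M. orthogonal y x)" for x
    by (auto simp: vec_eq_iff rows_def orthogonal_def inner_vec_def matrix_vector_mult_def row_def)
  also have "\<dots> x \<longleftrightarrow> (\<forall>y \<in> span (rows M). orthogonal y x)" for x
    by (meson orthogonal_commute orthogonal_to_span span_base)
  finally have "{x. M *v x = 0} = {x \<in> UNIV. \<forall>y \<in> span (rows M). orthogonal y x}"
    by simp
  then show ?thesis
    using dim_subspace_orthogonal_to_vectors[of "span (rows M)" UNIV]
    by (simp add: row_rank_def)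
qed

lemma adjacency_matrix_regular:
  fixes G :: "('v::finite, 'e) pre_digraph"
  assumes "verts G = UNIV" and "regular_graph G k"
  defines "A \<equiv> adjacency_matrix G"
  shows "A $ u $ v = A $ v $ u" and "A $ u $ u = 0" and "A $ u $ v = 0 \<or> A $ u $ v = 1"
    and "(\<Sum>v\<in>UNIV. A $ u $ v) = real k"
proof -
  interpret graph G
    using assms(2) by (simp add: regular_graph_def)
  show "A $ u $ v = A $ v $ u"
    using arcs_ends_symmetric[OF sym_arcs] by (auto simp: A_def adjacency_matrix_def)
  show "A $ u $ u = 0"
    using adj_not_same by (auto simp: A_def adjacency_matrix_def)
  show "A $ u $ v = 0 \<or> A $ u $ v = 1"
    by (simp add: A_def adjacency_matrix_def)
  \<comment> \<open>Without parallel arcs, \<open>head\<close> matches the arcs out of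
    \<open>u\<close> with its neighbours, so the degree counts the ones in row
    \<open>u\<close>.\<close>
  have "inj_on (head G) (out_arcs G u)"
    using no_multi_arcs by (auto simp: inj_on_def arc_to_ends_def)
  moreover have "head G ` out_arcs G u = {v. u \<rightarrow>\<^bsub>G\<^esub> v}"
    by (force simp: arcs_ends_conv)
  ultimately have "card {v. u \<rightarrow>\<^bsub>G\<^esub> v} = out_degree G u"
    unfolding out_degree_def by (metis card_image)
  also have "\<dots> = k"
    using assms by (simp add: regular_graph_def)
  finally show "(\<Sum>v\<in>UNIV. A $ u $ v) = real k"
    by (simp add: A_def adjacency_matrix_def sum.If_cases)
qed

theorem theorem5p3:
  fixes G :: "('v::finite, 'e) pre_digraph"
    and A :: "real ^ 'v ^ 'v"
    and n k d :: nat
    and lam :: real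
  assumes "verts G = UNIV"
    and "card (verts G) = n"
    and "regular_graph G k"
    and "Digraph_Component.connected G"
    and "A = adjacency_matrix G"
    and "eigenvalue A lam"
    and "eigenvalue_multiplicity A lam + d = n"
    and "d \<ge> 2"
    and "lam \<notin> {0, -1, real k}"
    and "2 * lam - 2 * real k + real n \<noteq> 0 \<Longrightarrow>
      \<not> eigenvalue A (lam * (2 * lam - 2 * real k - lam * real n) / (2 * lam - 2 * real k + real n))"
  shows "real n \<le> 1 / 2 * real d * (real d - 1)"
proof -
  have n: "CARD('v) = n"
    using assms(1,2) by simp
  have n2: "n \<ge> 2"
    using assms(7,8) by simp
  note adj = adjacency_matrix_regular[OF assms(1,3), folded assms(5)]
  \<comment> \<open>By symmetry the columns sum to \<open>k\<close> as well, so \<open>A\<close>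
    multiplies the coordinate sum of every vector by \<open>k\<close>.\<close>
  have col: "(\<Sum>u\<in>UNIV. A $ u $ v) = real k" for v
    using adj(4)[of v] by (simp add: adj(1)[of _ v])
  have sum_A: "(\<Sum>u\<in>UNIV. (A *v x) $ u) = real k * (\<Sum>u\<in>UNIV. x $ u)" for x
  proof -
    have "(\<Sum>u\<in>UNIV. (A *v x) $ u) = (\<Sum>v\<in>UNIV. \<Sum>u\<in>UNIV. A $ u $ v * x $ v)"
      by (simp add: matrix_vector_mult_def) (rule sum.swap)
    then show ?thesis
      by (simp add: sum_distrib_right[symmetric] col sum_distrib_left)
  qed
  define t where "t = (lam - real k) / real n"
  have tn: "real n * t = lam - real k"
    using n2 by (simp add: t_def)
  define M :: "real ^ 'v ^ 'v" where "M = (\<chi> u v. (if u = v then lam else 0) - A $ u $ v - t)"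
  define N :: "real ^ 'v ^ 'v" where "N = (\<chi> u v. (M $ u $ v)\<^sup>2)"

  have Mv: "(M *v x) $ u = lam * x $ u - (A *v x) $ u - t * (\<Sum>v\<in>UNIV. x $ v)" for x u
    by (simp add: M_def matrix_vector_mult_def left_diff_distrib sum_subtractf sum_distrib_left
        if_distrib[of "\<lambda>c. c * _"] cong: if_cong)
  have "rank M + 1 \<le> d"
  proof -
    let ?one = "1 :: real ^ 'v"
    \<comment> \<open>On the eigenspace, \<open>A\<close> scales the coordinate sum both by
      \<open>lam\<close> and by \<open>k\<close>, which differ.\<close>
    have sum0: "(\<Sum>v\<in>UNIV. x $ v) = 0" if "x \<in> eigenspace A lam" for x
    proof -
      have "lam * (\<Sum>v\<in>UNIV. x $ v) = real k * (\<Sum>v\<in>UNIV. x $ v)"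
        using sum_A[of x] that by (simp add: eigenspace_def sum_distrib_left)
      then show ?thesis
        using assms(9) by simp
    qed
    have "subspace (eigenspace A lam)"
      by (auto simp: subspace_def eigenspace_def matrix_vector_right_distrib scaleR_right_distrib
          matrix_vector_mult_scaleR)
    moreover have "?one \<notin> eigenspace A lam"
      using sum0[of ?one] n n2 by auto
    ultimately have "dim (insert ?one (eigenspace A lam)) = dim (eigenspace A lam) + 1"
      by (simp add: dim_insert span_eq_iff[THEN iffD2])
    moreover have "insert ?one (eigenspace A lam) \<subseteq> {x. M *v x = 0}"
    proof -
      have "M *v ?one = 0"
        using tn adj(4) n by (simp add: vec_eq_iff Mv) (simp add: matrix_vector_mult_def mult.commute)
      moreover have "M *v x = 0" if "x \<in> eigenspace A lam" for x
        using sum0[OF that] that by (simp add: vec_eq_iff Mv eigenspace_def)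
      ultimately show ?thesis
        by auto
    qed
    ultimately have "dim (eigenspace A lam) + 1 \<le> dim {x. M *v x = 0}"
      by (metis dim_subset)
    then show ?thesis
      using rank_add_dim_kernel[of M] assms(7) n by (simp add: eigenvalue_multiplicity_def)
  qed

  have "x = 0" if "N *v x = 0" for x
  proof -
    let ?s = "\<Sum>v\<in>UNIV. x $ v"
    \<comment> \<open>Squaring stays linear in \<open>A\<close>: its entries are idempotent, and its
      zero diagonal kills the cross term with \<open>lam\<close>.\<close>
    have N_entry: "N $ u $ v = (if u = v then lam\<^sup>2 - 2 * lam * t else 0) + (1 + 2 * t) * A $ u $ v + t\<^sup>2" for u v
      using adj(2)[of u] adj(3)[of u v] by (auto simp: N_def M_def power2_eq_square algebra_simps)
    have Nv: "(N *v x) $ u = (lam\<^sup>2 - 2 * lam * t) * x $ u + (1 + 2 * t) * (A *v x) $ u + t\<^sup>2 * ?s" for u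
      by (simp add: matrix_vector_mult_def N_entry distrib_right sum.distrib sum_distrib_left mult.assoc
        if_distrib[of "\<lambda>c. c * _"] cong: if_cong)
    define r where "r = lam\<^sup>2 - 2 * lam * t + (1 + 2 * t) * real k + t\<^sup>2 * real n"
    have "r \<noteq> 0"
    proof
      assume "r = 0"
      \<comment> \<open>If row \<open>u\<close> of \<open>M\<close> vanished, its diagonal entry
        would give \<open>lam = t\<close> and its entry at \<open>v\<close> would give
        \<open>t = - A $ u $ v\<close>, so \<open>lam\<close> would be 0 or -1.\<close>
      obtain u v :: 'v where "u \<noteq> v"
        using n n2 card_le_Suc0_iff_eq[of "UNIV :: 'v set"] by force
      have "(\<Sum>w\<in>UNIV. N $ u $ w) = r"
        using n by (simp add: N_entry sum.distrib sum_distrib_left[symmetric] adj(4) r_def)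
      then have "(\<Sum>w\<in>UNIV. (M $ u $ w)\<^sup>2) = 0"
        using \<open>r = 0\<close> by (simp add: N_def)
      then have "M $ u $ w = 0" for w
        by (simp add: sum_nonneg_eq_0_iff)
      from this[of u] this[of v] show False
        using \<open>u \<noteq> v\<close> adj(2)[of u] adj(3)[of u v] assms(9) by (auto simp: M_def)
    qed
    moreover have "r * ?s = 0"
    proof -
      have "(\<Sum>u\<in>UNIV. (N *v x) $ u) = r * ?s"
        using n by (simp add: Nv sum.distrib sum_distrib_left[symmetric] sum_A)
          (simp add: r_def algebra_simps)
      then show ?thesis
        using that by simp
    qed
    ultimately have "?s = 0"
      by simp
    then have ev: "(1 + 2 * t) *\<^sub>R (A *v x) = (lam * (2 * t - lam)) *\<^sub>R x"
      using that Nv by (simp add: vec_eq_iff algebra_simps power2_eq_square) 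
    show "x = 0"
    proof (cases "1 + 2 * t = 0")
      case True
      then have "2 * t = - 1"
        by simp
      then have "lam * (2 * t - lam) \<noteq> 0"
        using assms(9) by auto
      then show ?thesis
        using ev True by simp
    next
      case False
      then have "A *v x = (lam * (2 * t - lam) / (1 + 2 * t)) *\<^sub>R x"
        using ev False by (simp add: vec_eq_iff field_simps)
      \<comment> \<open>Numerator and denominator of the excluded value share the factor
        \<open>n\<close>; cancelling it leaves the eigenvalue just found.\<close>
      moreover have den: "2 * lam - 2 * real k + real n = real n * (1 + 2 * t)"
        using tn by (simp add: algebra_simps)
      moreover have "2 * lam - 2 * real k - lam * real n = real n * (2 * t - lam)"
        using tn by (simp add: algebra_simps)
      then have "lam * (2 * lam - 2 * real k - lam * real n) / (2 * lam - 2 * real k + real n)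
          = lam * (2 * t - lam) / (1 + 2 * t)"
        using n2 by (simp add: den)
      ultimately show ?thesis
        using assms(10) False n2 unfolding eigenvalue_def by auto
    qed
  qed
  then have "rank N = n"
    using matrix_nonfull_linear_equations_eq[of N] n by auto
  then have "2 * n \<le> rank M * (rank M + 1)"
    using rank_hadamard_square_le[of N M] by (simp add: N_def)
  also have "\<dots> \<le> (d - 1) * d"
    using \<open>rank M + 1 \<le> d\<close> by (intro mult_mono) auto
  finally have "real (2 * n) \<le> real ((d - 1) * d)"
    by (rule of_nat_mono)
  then show ?thesis
    using assms(8) by (simp add: of_nat_diff algebra_simps)
qed

end
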